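(* For every $a\in\mathbb{C}$ with $\tfrac32-2a\notin\{0,-1,-2,\dots\}$, $$F\!\left(\tfrac12,\tfrac32-3a;\tfrac32-2a;-\tfrac13\right)=\sqrt{\tfrac23}\;\frac{\Gamma(\tfrac54-a)\,\Gamma(\tfrac34-a)}{\Gamma(\tfrac76-a)\,\Gamma(\tfrac56-a)}.$$
   Context: $F(a,b;c;x)=\sum_{n\ge0}\frac{(a,n)(b,n)}{(c,n)(1,n)}x^n$ with $(\alpha,n)=\Gamma(\alpha+n)/\Gamma(\alpha)$ is the Gauss hypergeometric series. $1/\Gamma$ is interpreted as $0$ at the poles of $\Gamma$. *)

theory Defs
  imports "HOL-Analysis.Analysis"
begin

text \<open>
  The symbol \<open>(\<alpha>, n) = \<Gamma>(\<alpha> + n) / \<Gamma>(\<alpha>)\<close> is rendered as \<^const>\<open>pochhammer\<close>. The two agree whenever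
  \<open>\<alpha>\<close> is not a pole of \<open>\<Gamma>\<close> (\<open>pochhammer_Gamma\<close>); at a pole, \<^const>\<open>pochhammer\<close> is the limiting value
  of the quotient, so that the series terminates when \<open>a\<close> or \<open>b\<close> is a non-positive integer.
\<close>

definition hypergeo_F :: "complex \<Rightarrow> complex \<Rightarrow> complex \<Rightarrow> complex \<Rightarrow> complex" where
  "hypergeo_F a b c x =
     (\<Sum>n. pochhammer a n * pochhammer b n / (pochhammer c n * pochhammer 1 n) * x ^ n)"

lemma hypergeo_F_eq_eval_fps:
  "hypergeo_F a b c x = eval_fps (fps_hypergeo [a, b] [c] 1) x"
  by (simp add: hypergeo_F_def eval_fps_def pochhammer_fact [symmetric] mult_ac)

end

theory Submission
  imports Defs "HOL-Real_Asymp.Real_Asymp"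
begin

text \<open>
  Write \<open>f(a)\<close> for the left-hand side. Its parameters \<open>b = 3/2 - 3a\<close> and \<open>c = 3/2 - 2a\<close> satisfy
  \<open>c = 1/2 + 2b/3\<close>, and on this line the argument \<open>-1/3\<close> is exceptional: the step \<open>a \<mapsto> a - 1\<close>, that
  is \<open>(b, c) \<mapsto> (b + 3, c + 2)\<close>, changes the sum only by a rational factor,
  \[ f(a) = \frac{(5/6 - a)(7/6 - a)}{(3/4 - a)(5/4 - a)} f(a - 1). \]
  Creative telescoping proves this: a suitable combination of the summands of \<open>f(a - 1)\<close> and \<open>f(a)\<close>
  is the difference of an explicit sequence (\<open>half_term_telescope\<close>) that starts at \<open>0\<close> and tends
  to \<open>0\<close>.

  Iterating, \<open>f(a)\<close> is a quotient of Pochhammer symbols of length \<open>N\<close> times \<open>f(a - N)\<close>, and it remains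
  to let \<open>N\<close> tend to infinity. In \<open>f(a - N)\<close> the quotient of the Pochhammer symbols of
  \<open>b + 3N\<close> and \<open>c + 2N\<close> of length \<open>n\<close> tends to \<open>(3/2)^n\<close>, so the series becomes the binomial series of
  \<open>(1 + 1/2) powr (-1/2) = sqrt (2/3)\<close>; the bound \<open>2^n\<close> for those quotients together with
  the factor \<open>3^(-n)\<close> makes this limit legitimate by Tannery's theorem. The prefactor tends to the
  quotient of Gamma values by Gauss's product, because \<open>5/6 + 7/6 = 3/4 + 5/4\<close>.
\<close>

section \<open>Growth of quotients of Pochhammer symbols\<close>

lemma norm_pochhammer_quotient_le:
  fixes b c :: complex
  assumes "\<And>k. norm (b + of_nat k) \<le> r * norm (c + of_nat k)" and "r \<ge> 0"
  shows "norm (pochhammer b n / pochhammer c n) \<le> r ^ n"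
proof (induction n)
  case (Suc n)
  have "norm ((b + of_nat n) / (c + of_nat n)) \<le> r"
  proof (cases "c + of_nat n = 0")
    case False
    then show ?thesis using assms(1)[of n] by (simp add: norm_divide divide_le_eq)
  qed (use assms(2) in simp)
  then have "norm (pochhammer b n / pochhammer c n) * norm ((b + of_nat n) / (c + of_nat n))
      \<le> r ^ n * r"
    using Suc assms(2) by (intro mult_mono) auto
  then show ?case
    by (simp add: pochhammer_Suc norm_mult norm_divide mult.commute)
qed simp

text \<open>
  The ratio of consecutive quotients tends to \<open>1\<close>, hence is eventually at most \<open>2\<close>; the finitely many
  exceptions only cost a constant.
\<close>

lemma norm_pochhammer_quotient_bound:
  fixes b c :: complex
  shows "\<exists>C. \<forall>n. norm (pochhammer b n / pochhammer c n) \<le> C * 2 ^ n"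
proof -
  define K where "K = nat \<lceil>norm b + 2 * norm c\<rceil>"
  have K: "norm b + 2 * norm c \<le> real K" unfolding K_def by linarith
  have le: "norm (b + of_nat K + of_nat k) \<le> 2 * norm (c + of_nat K + of_nat k)" for k
  proof -
    have "norm (b + of_nat K + of_nat k) \<le> norm b + real K + real k"
      by (metis norm_of_nat norm_triangle_le add_mono norm_triangle_ineq order_refl)
    moreover have "real K + real k - norm c \<le> norm (c + of_nat K + of_nat k)"
      using norm_diff_ineq[of "of_nat (K + k) :: complex" c] by (simp add: add_ac flip: of_nat_add)
    ultimately show ?thesis using K by linarith
  qed
  define q where "q n = norm (pochhammer b n / pochhammer c n) / 2 ^ n" for n
  have "q (n + K) \<le> q K" for n
  proof -
    have "q (n + K) = q K * (norm (pochhammer (b + of_nat K) n / pochhammer (c + of_nat K) n) / 2 ^ n)"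
      by (simp add: q_def add.commute[of n K] pochhammer_product' norm_mult norm_divide power_add)
    also have "\<dots> \<le> q K * 1"
      using norm_pochhammer_quotient_le[OF le, of n]
      by (intro mult_left_mono) (auto simp: q_def divide_le_eq)
    finally show ?thesis by simp
  qed
  then have "Bseq (\<lambda>n. q (n + K))"
    by (intro BseqI'[of _ "q K"]) (simp add: q_def)
  then have "Bseq q" by (rule Bseq_offset)
  then obtain C where "\<And>n. norm (q n) \<le> C" unfolding Bseq_def by blast
  then have "\<forall>n. norm (pochhammer b n / pochhammer c n) \<le> C * 2 ^ n"
    by (simp add: q_def divide_le_eq)
  then show ?thesis by blast
qed

section \<open>The summand\<close>

definition half_term :: "complex \<Rightarrow> complex \<Rightarrow> nat \<Rightarrow> complex" where
  "half_term b c n =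
     pochhammer (1 / 2) n / pochhammer 1 n * (pochhammer b n / pochhammer c n) * (- 1 / 3) ^ n"

lemma hypergeo_F_half: "hypergeo_F (1 / 2) b c (- 1 / 3) = (\<Sum>n. half_term b c n)"
  by (simp add: hypergeo_F_def half_term_def mult_ac)

lemma norm_half_term_le:
  assumes "norm (pochhammer b n / pochhammer c n) \<le> C * 2 ^ n"
  shows "norm (half_term b c n) \<le> C * (2 / 3) ^ n"
proof -
  have "norm (1 / 2 + of_nat k :: complex) \<le> 1 * norm (1 + of_nat k :: complex)" for k
  proof -
    have "(1 / 2 + of_nat k :: complex) = of_real (1 / 2 + real k)"
         "(1 + of_nat k :: complex) = of_real (1 + real k)" by simp_all
    then show ?thesis by (simp only: norm_of_real) simp
  qed
  from norm_pochhammer_quotient_le[OF this, of n]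
  have "norm (pochhammer (1 / 2 :: complex) n / pochhammer 1 n) \<le> 1" by simp
  then have "norm (half_term b c n) \<le> 1 * (C * 2 ^ n) * (1 / 3) ^ n"
    unfolding half_term_def norm_mult using assms
    using order_trans[OF norm_ge_zero assms] by (intro mult_mono) (auto simp: norm_power norm_divide)
  then show ?thesis by (simp add: power_divide)
qed

lemma summable_half_term: "summable (half_term b c)"
proof -
  obtain C where "\<And>n. norm (pochhammer b n / pochhammer c n) \<le> C * 2 ^ n"
    using norm_pochhammer_quotient_bound[of b c] by blast
  then have "norm (half_term b c n) \<le> C * (2 / 3) ^ n" for n
    by (rule norm_half_term_le)
  moreover have "summable (\<lambda>n. C * (2 / 3) ^ n)"
    by (intro summable_mult summable_geometric) simp
  ultimately show ?thesis
    using summable_comparison_test' by blast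
qed

lemma quadratic_half_term_tendsto_0:
  "(\<lambda>n. (2 * of_nat n + 5) * (2 * of_nat n + 1) * half_term b c n) \<longlonglongrightarrow> 0"
proof -
  obtain C where C: "\<And>n. norm (pochhammer b n / pochhammer c n) \<le> C * 2 ^ n"
    using norm_pochhammer_quotient_bound[of b c] by blast
  have "(\<lambda>n. (2 * real n + 5) * (2 * real n + 1) * (2 / 3) ^ n) \<longlonglongrightarrow> 0"
    by real_asymp
  then have lim: "(\<lambda>n. (2 * real n + 5) * (2 * real n + 1) * (2 / 3) ^ n * C) \<longlonglongrightarrow> 0"
    by (rule tendsto_mult_left_zero)
  show ?thesis
  proof (rule Lim_null_comparison[OF _ lim], intro always_eventually allI)
    fix n
    have "(2 * of_nat n + 5) * (2 * of_nat n + 1) = (of_real ((2 * real n + 5) * (2 * real n + 1)) :: complex)"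
      by simp
    then have "norm ((2 * of_nat n + 5) * (2 * of_nat n + 1) :: complex)
        = (2 * real n + 5) * (2 * real n + 1)"
      by (simp only: norm_of_real) simp
    then have "norm ((2 * of_nat n + 5) * (2 * of_nat n + 1) * half_term b c n)
        = (2 * real n + 5) * (2 * real n + 1) * norm (half_term b c n)"
      by (simp only: norm_mult)
    also have "\<dots> \<le> (2 * real n + 5) * (2 * real n + 1) * (C * (2 / 3) ^ n)"
      by (intro mult_left_mono norm_half_term_le C) auto
    finally show "norm ((2 * of_nat n + 5) * (2 * of_nat n + 1) * half_term b c n)
        \<le> (2 * real n + 5) * (2 * real n + 1) * (2 / 3) ^ n * C"
      by (simp add: mult_ac)
  qed
qed

section \<open>The contiguous relation\<close>

text \<open>
  The sequence whose differences telescope: it equals the summand \<open>half_term b c n\<close> multiplied by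
  \<open>- n (2n + 3) / (6b (c + n))\<close>. Dividing the summand by \<open>b\<close> replaces the Pochhammer symbol of \<open>b\<close> by
  one of \<open>b + 1\<close> that is shorter by one, so the form below also makes sense for \<open>b = 0\<close>.
  The factor \<open>2n + 3\<close> comes from an ansatz with a linear polynomial in \<open>n\<close>, whose coefficients the
  telescoping equation determines.
\<close>

definition certificate :: "complex \<Rightarrow> complex \<Rightarrow> nat \<Rightarrow> complex" where
  "certificate b c n = (case n of 0 \<Rightarrow> 0
     | Suc m \<Rightarrow> (2 * of_nat m + 5) * (2 * of_nat m + 1) / (36 * c * (c + 1)) *
                 half_term (b + 1) (c + 2) m)"

lemma nonpos_Ints_add_of_nat: "c \<notin> \<int>\<^sub>\<le>\<^sub>0 \<Longrightarrow> c + of_nat n \<noteq> (0 :: complex)"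
  using plus_of_nat_eq_0_imp by blast

text \<open>
  For \<open>n = Suc m\<close> both summands and both values of the certificate are rational multiples of
  \<open>half_term (b + 1) (c + 2) m\<close>, so the claim is an identity between rational functions of \<open>b\<close> and
  \<open>m\<close>. This is where the relation between \<open>b\<close> and \<open>c\<close> and the argument \<open>-1/3\<close> enter.
\<close>

lemma half_term_telescope:
  assumes c: "c = 1 / 2 + 2 * b / 3" and nz: "c \<notin> \<int>\<^sub>\<le>\<^sub>0"
  shows "4 * (b + 1) * (b + 2) / (9 * c * (c + 1)) * half_term (b + 3) (c + 2) n - half_term b c n
           = certificate b c (Suc n) - certificate b c n"
proof -
  have c0: "c \<noteq> 0" and c1: "c + 1 \<noteq> 0"
    using nonpos_Ints_add_of_nat[OF nz, of 0] nonpos_Ints_add_of_nat[OF nz, of 1] by simp_all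
  show ?thesis
  proof (cases n)
    case 0
    have "4 * (b + 1) * (b + 2) = 9 * c * (c + 1) + 5 / 4"
      by (simp add: c algebra_simps)
    then have "4 * (b + 1) * (b + 2) / (9 * c * (c + 1)) - 1 = 5 / (36 * c * (c + 1))"
      using c0 c1 by (simp add: add_divide_distrib)
    then show ?thesis using 0 by (simp add: half_term_def certificate_def)
  next
    case (Suc m)
    define s where "s = (of_nat m :: complex)"
    define V where "V = half_term (b + 1) (c + 2) m"
    define W where "W = half_term (b + 1) (c + 2) (Suc m)"
    have s1: "s + 1 \<noteq> 0" unfolding s_def using of_nat_neq_0[of m, where 'a = complex] by (simp add: add.commute)
    have cs1: "c + s + 1 \<noteq> 0" and cs2: "c + s + 2 \<noteq> 0"
      using nonpos_Ints_add_of_nat[OF nz, of "m + 1"] nonpos_Ints_add_of_nat[OF nz, of "m + 2"]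
      by (simp_all add: s_def add_ac)
    have W: "W = - ((1 / 2 + s) * (b + 1 + s) / (3 * (s + 1) * (c + s + 2))) * V"
      using s1 cs2 by (simp add: W_def V_def half_term_def pochhammer_Suc s_def add_ac mult_ac)
    have up: "(b + 1) * (b + 2) * half_term (b + 3) (c + 2) n = (b + 2 + s) * (b + 3 + s) * W"
    proof -
      have "(b + 1) * (b + 2) * pochhammer (b + 3) n = pochhammer (b + 1) (Suc (Suc n))"
        by (simp add: pochhammer_rec add.assoc)
      also have "\<dots> = pochhammer (b + 1) n * ((b + 2 + s) * (b + 3 + s))"
        by (simp add: pochhammer_Suc Suc s_def add_ac mult_ac)
      finally have eq: "(b + 1) * (b + 2) * pochhammer (b + 3) n
          = pochhammer (b + 1) n * ((b + 2 + s) * (b + 3 + s))" .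
      have "(b + 1) * (b + 2) * half_term (b + 3) (c + 2) n =
          pochhammer (1 / 2) n / pochhammer 1 n *
          ((b + 1) * (b + 2) * pochhammer (b + 3) n / pochhammer (c + 2) n) * (- 1 / 3) ^ n"
        by (simp add: half_term_def)
      also have "\<dots> = (b + 2 + s) * (b + 3 + s) * W"
        unfolding eq unfolding W_def half_term_def Suc by simp
      finally show ?thesis .
    qed
    have down: "half_term b c n = - ((1 / 2 + s) * b * (c + s + 1) / (3 * (s + 1) * c * (c + 1))) * V"
    proof -
      have "pochhammer c (Suc (Suc m)) = c * (c + 1) * pochhammer (c + 2) m"
        by (simp add: pochhammer_rec add.assoc)
      then have "pochhammer c (Suc m) * (c + s + 1) = c * (c + 1) * pochhammer (c + 2) m"
        by (simp add: pochhammer_Suc[of c "Suc m"] s_def add_ac)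
      then have pc: "pochhammer c (Suc m) = c * (c + 1) * pochhammer (c + 2) m / (c + s + 1)"
        using cs1 by (simp add: eq_divide_eq)
      have "half_term b c n = (1 / 2 + s) / (1 + s) * (pochhammer (1 / 2) m / pochhammer 1 m) *
         (b * pochhammer (b + 1) m / (c * (c + 1) * pochhammer (c + 2) m / (c + s + 1))) *
         ((- 1 / 3) * (- 1 / 3) ^ m)"
        unfolding half_term_def Suc pc pochhammer_rec[of b m] by (simp add: pochhammer_Suc s_def mult_ac)
      then show ?thesis by (simp add: V_def half_term_def add_ac mult_ac)
    qed
    have "4 * (b + 1) * (b + 2) / (9 * c * (c + 1)) * half_term (b + 3) (c + 2) n
        = 4 / (9 * c * (c + 1)) * ((b + 2 + s) * (b + 3 + s) * W)"
      by (simp flip: up)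
    moreover have "certificate b c (Suc n) = (2 * s + 7) * (2 * s + 3) / (36 * c * (c + 1)) * W"
      by (simp add: certificate_def Suc W_def s_def algebra_simps)
    moreover have "certificate b c n = (2 * s + 5) * (2 * s + 1) / (36 * c * (c + 1)) * V"
      by (simp add: certificate_def Suc V_def s_def)
    moreover have "4 / (9 * c * (c + 1)) * ((b + 2 + s) * (b + 3 + s) * W)
        + (1 / 2 + s) * b * (c + s + 1) / (3 * (s + 1) * c * (c + 1)) * V
        = (2 * s + 7) * (2 * s + 3) / (36 * c * (c + 1)) * W
        - (2 * s + 5) * (2 * s + 1) / (36 * c * (c + 1)) * V"
    proof -
      \<comment> \<open>Over the common denominator \<open>K\<close> only the polynomial identity \<open>key\<close> is left.\<close>
      define D where "D = 3 * (s + 1) * (c + s + 2)"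
      define R where "R = (1 / 2 + s) * (b + 1 + s)"
      have D0: "D \<noteq> 0" using s1 cs2 unfolding D_def mult_eq_0_iff by simp
      define K where "K = 36 * c * (c + 1) * D"
      have key: "16 * ((b + 2 + s) * (b + 3 + s)) * - R + (1 / 2 + s) * b * (c + s + 1) * (36 * (c + s + 2))
        = (2 * s + 7) * (2 * s + 3) * - R - (2 * s + 5) * (2 * s + 1) * D"
        unfolding R_def D_def c by algebra
      have "4 / (9 * c * (c + 1)) * (P * (- (R / D) * V)) = 16 * P * - R * V / K" for P
        using c0 c1 D0 by (simp add: K_def)
      moreover have "P / (3 * (s + 1) * c * (c + 1)) * V = P * (36 * (c + s + 2)) * V / K" for P
      proof -
        have "x / y * V = x * w * V / (y * w)" if "w \<noteq> 0" for x y w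
          using that by simp
        moreover have "K = 3 * (s + 1) * c * (c + 1) * (36 * (c + s + 2))" by (simp add: K_def D_def)
        moreover have "36 * (c + s + 2) \<noteq> 0" using cs2 unfolding mult_eq_0_iff by simp
        ultimately show ?thesis by metis
      qed
      moreover have "P / (36 * c * (c + 1)) * (- (R / D) * V) = P * - R * V / K" for P
        by (simp add: K_def)
      moreover have "P / (36 * c * (c + 1)) * V = P * D * V / K" for P
        using D0 by (simp add: K_def)
      ultimately have "4 / (9 * c * (c + 1)) * ((b + 2 + s) * (b + 3 + s) * (- (R / D) * V))
        + (1 / 2 + s) * b * (c + s + 1) / (3 * (s + 1) * c * (c + 1)) * V
        = (2 * s + 7) * (2 * s + 3) / (36 * c * (c + 1)) * (- (R / D) * V)
        - (2 * s + 5) * (2 * s + 1) / (36 * c * (c + 1)) * V"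
        by (simp only: key flip: add_divide_distrib diff_divide_distrib distrib_right left_diff_distrib)
      then show ?thesis unfolding W R_def D_def .
    qed
    ultimately show ?thesis by (simp only: down mult_minus_left diff_minus_eq_add)
  qed
qed

lemma hypergeo_F_half_shift:
  assumes c: "c = 1 / 2 + 2 * b / 3" and nz: "c \<notin> \<int>\<^sub>\<le>\<^sub>0"
  shows "hypergeo_F (1 / 2) b c (- 1 / 3) =
           4 * (b + 1) * (b + 2) / (9 * c * (c + 1)) * hypergeo_F (1 / 2) (b + 3) (c + 2) (- 1 / 3)"
proof -
  define r where "r = 4 * (b + 1) * (b + 2) / (9 * c * (c + 1))"
  have "(\<lambda>n. certificate b c (Suc n)) \<longlonglongrightarrow> 0"
    using tendsto_mult_right_zero[OF quadratic_half_term_tendsto_0[of "b + 1" "c + 2"],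
        of "1 / (36 * c * (c + 1))"]
    by (simp add: certificate_def)
  then have "certificate b c \<longlonglongrightarrow> 0" by (simp only: filterlim_sequentially_Suc)
  then have "(\<lambda>n. certificate b c (Suc n) - certificate b c n) sums (0 - certificate b c 0)"
    by (rule telescope_sums)
  then have "(\<lambda>n. r * half_term (b + 3) (c + 2) n - half_term b c n) sums 0"
    unfolding r_def half_term_telescope[OF assms] by (simp add: certificate_def)
  moreover have "(\<lambda>n. r * half_term (b + 3) (c + 2) n - half_term b c n) sums
      (r * suminf (half_term (b + 3) (c + 2)) - suminf (half_term b c))"
    by (intro sums_diff sums_mult summable_sums summable_half_term)
  ultimately have "r * suminf (half_term (b + 3) (c + 2)) - suminf (half_term b c) = 0"
    using sums_unique2 by blast
  then have "suminf (half_term b c) = r * suminf (half_term (b + 3) (c + 2))" by simp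
  then show ?thesis by (simp only: hypergeo_F_half r_def)
qed

section \<open>Iteration and passage to the limit\<close>

lemma hypergeo_F_half_iterate:
  fixes a :: complex
  assumes "3 / 2 - 2 * a \<notin> \<int>\<^sub>\<le>\<^sub>0"
  shows "hypergeo_F (1 / 2) (3 / 2 - 3 * a) (3 / 2 - 2 * a) (- 1 / 3) =
    pochhammer (7 / 6 - a) N * pochhammer (5 / 6 - a) N /
      (pochhammer (5 / 4 - a) N * pochhammer (3 / 4 - a) N) *
    hypergeo_F (1 / 2) (3 / 2 - 3 * a + 3 * of_nat N) (3 / 2 - 2 * a + 2 * of_nat N) (- 1 / 3)"
proof (induction N)
  case (Suc N)
  define z where "z = of_nat N - a"
  define b where "b = 3 / 2 + 3 * z"
  define c where "c = 3 / 2 + 2 * z"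
  have c_nz: "c \<notin> \<int>\<^sub>\<le>\<^sub>0"
  proof
    assume "c \<in> \<int>\<^sub>\<le>\<^sub>0"
    then obtain n where "c = - of_nat n" by (rule nonpos_Ints_cases')
    then have "3 / 2 - 2 * a + of_nat (n + 2 * N) = 0"
      by (simp add: c_def z_def algebra_simps)
    with assms show False using plus_of_nat_eq_0_imp by blast
  qed
  have eq: "4 * (b + 1) * (b + 2) / (9 * c * (c + 1)) =
      (7 / 6 + z) * (5 / 6 + z) / ((5 / 4 + z) * (3 / 4 + z))"
  proof -
    have "4 * (b + 1) * (b + 2) = 36 * ((7 / 6 + z) * (5 / 6 + z))"
         "9 * c * (c + 1) = 36 * ((5 / 4 + z) * (3 / 4 + z))"
      by (simp_all add: b_def c_def algebra_simps)
    then show ?thesis by (simp only: mult_divide_mult_cancel_left_if) simp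
  qed
  have "c = 1 / 2 + 2 * b / 3" by (simp add: b_def c_def field_simps)
  from hypergeo_F_half_shift[OF this c_nz]
  have shift: "hypergeo_F (1 / 2) b c (- 1 / 3) =
      (7 / 6 + z) * (5 / 6 + z) / ((5 / 4 + z) * (3 / 4 + z)) *
      hypergeo_F (1 / 2) (b + 3) (c + 2) (- 1 / 3)"
    unfolding eq .
  have params: "3 / 2 - 3 * a + 3 * of_nat N = b" "3 / 2 - 2 * a + 2 * of_nat N = c"
      "3 / 2 - 3 * a + 3 * of_nat (Suc N) = b + 3" "3 / 2 - 2 * a + 2 * of_nat (Suc N) = c + 2"
    by (simp_all add: b_def c_def z_def algebra_simps)
  have poch: "pochhammer (y - a) (Suc N) = pochhammer (y - a) N * (y + z)" for y
    by (simp add: pochhammer_Suc z_def)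
  show ?case
    unfolding Suc.IH params shift poch
    by simp (simp only: mult_ac)
qed simp

lemma half_binomial_series:
  "(\<Sum>n. pochhammer (1 / 2) n / pochhammer 1 n * (3 / 2) ^ n * (- 1 / 3) ^ n) =
     complex_of_real (sqrt (2 / 3))"
proof -
  have "(\<lambda>n. ((- 1 / 2 :: complex) gchoose n) * (1 / 2) ^ n) sums (1 + 1 / 2) powr (- 1 / 2)"
    by (rule gen_binomial_complex) (simp add: norm_divide)
  moreover have "((- 1 / 2 :: complex) gchoose n) * (1 / 2) ^ n =
      pochhammer (1 / 2) n / pochhammer 1 n * (3 / 2) ^ n * (- 1 / 3) ^ n" for n
  proof -
    have "(3 / 2) ^ n * (- 1 / 3) ^ n = (- 1) ^ n * (1 / 2 :: complex) ^ n"
      by (simp flip: power_mult_distrib)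
    then show ?thesis by (simp add: gbinomial_pochhammer pochhammer_fact mult_ac)
  qed
  moreover have "(1 + 1 / 2) powr (- 1 / 2) = complex_of_real (sqrt (2 / 3))"
  proof -
    have "(1 + 1 / 2) powr (- 1 / 2) = complex_of_real ((3 / 2) powr (- (1 / 2)))"
      by (subst powr_of_real [symmetric]) simp_all
    also have "(3 / 2 :: real) powr (- (1 / 2)) = sqrt (2 / 3)"
      by (simp add: powr_minus powr_half_sqrt real_sqrt_divide)
    finally show ?thesis .
  qed
  ultimately show ?thesis by (simp add: sums_iff)
qed

text \<open>
  For large \<open>N\<close> each factor \<open>(b + 3N + k) / (c + 2N + k)\<close> has norm at most \<open>2\<close>, uniformly in \<open>k\<close>.
\<close>

lemma hypergeo_F_half_tendsto:
  "(\<lambda>N. hypergeo_F (1 / 2) (b + 3 * of_nat N) (c + 2 * of_nat N) (- 1 / 3))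
     \<longlonglongrightarrow> complex_of_real (sqrt (2 / 3))"
proof -
  have quot: "(\<lambda>N. pochhammer (b + 3 * of_nat N) n / pochhammer (c + 2 * of_nat N) n)
      \<longlonglongrightarrow> (3 / 2) ^ n" for n
  proof (induction n)
    case (Suc n)
    have "(\<lambda>N. ((b + of_nat n) / of_nat N + 3) / ((c + of_nat n) / of_nat N + 2))
        \<longlonglongrightarrow> (0 + 3) / (0 + 2 :: complex)"
      by (intro tendsto_intros lim_const_over_n) simp
    moreover have "\<forall>\<^sub>F N in sequentially.
        ((b + of_nat n) / of_nat N + 3) / ((c + of_nat n) / of_nat N + 2)
        = (b + 3 * of_nat N + of_nat n) / (c + 2 * of_nat N + of_nat n)"
      using eventually_gt_at_top[of 0]
    proof eventually_elim
      case (elim N)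
      then have "((b + of_nat n) / of_nat N + 3) = (b + 3 * of_nat N + of_nat n) / of_nat N"
        "((c + of_nat n) / of_nat N + 2) = (c + 2 * of_nat N + of_nat n) / of_nat N"
        by (simp_all add: field_simps)
      then show ?case using elim by simp
    qed
    ultimately have "(\<lambda>N. (b + 3 * of_nat N + of_nat n) / (c + 2 * of_nat N + of_nat n))
        \<longlonglongrightarrow> 3 / 2"
      using Lim_transform_eventually by fastforce
    from tendsto_mult[OF Suc this] show ?case by (simp add: pochhammer_Suc mult.commute)
  qed (simp)
  define M where "M = nat \<lceil>norm b + 2 * norm c\<rceil>"
  have bound: "norm (half_term (b + 3 * of_nat N) (c + 2 * of_nat N) n) \<le> (2 / 3) ^ n"
    if N: "N \<ge> M" for N n
  proof -
    have "norm b + 2 * norm c \<le> real M" unfolding M_def by linarith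
    then have N': "norm b + 2 * norm c \<le> real N" using N by linarith
    have "norm (b + 3 * of_nat N + of_nat k) \<le> 2 * norm (c + 2 * of_nat N + of_nat k)" for k
    proof -
      have "norm (b + 3 * of_nat N + of_nat k) \<le> norm b + real (3 * N + k)"
        using norm_triangle_ineq[of b "of_nat (3 * N + k)"] 
        by (simp only: norm_of_nat) (simp add: add_ac)
      moreover have "real (2 * N + k) - norm c \<le> norm (c + 2 * of_nat N + of_nat k)"
        using norm_diff_ineq[of "of_nat (2 * N + k) :: complex" c]
        by (simp only: norm_of_nat) (simp add: add_ac)
      ultimately show ?thesis using N' by simp
    qed
    from norm_pochhammer_quotient_le[OF this, of n]
    have "norm (pochhammer (b + 3 * of_nat N) n / pochhammer (c + 2 * of_nat N) n) \<le> 1 * 2 ^ n"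
      by simp
    from norm_half_term_le[OF this] show ?thesis by simp
  qed
  have "((\<lambda>N. \<Sum>n. half_term (b + 3 * of_nat N) (c + 2 * of_nat N) n) \<longlongrightarrow>
      (\<Sum>n. pochhammer (1 / 2) n / pochhammer 1 n * (3 / 2) ^ n * (- 1 / 3) ^ n)) sequentially"
  proof (rule tannerys_theorem[THEN conjunct2, THEN conjunct2])
    show "((\<lambda>N. half_term (b + 3 * of_nat N) (c + 2 * of_nat N) n) \<longlongrightarrow>
        pochhammer (1 / 2) n / pochhammer 1 n * (3 / 2) ^ n * (- 1 / 3) ^ n) sequentially" for n
      unfolding half_term_def by (intro tendsto_intros quot)
    show "\<forall>\<^sub>F (n, N) in sequentially \<times>\<^sub>F sequentially.
        norm (half_term (b + 3 * of_nat N) (c + 2 * of_nat N) n) \<le> (2 / 3) ^ n"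
      unfolding eventually_prod_filter
      by (rule exI[of _ "\<lambda>_. True"], rule exI[of _ "\<lambda>N. N \<ge> M"]) (auto intro: bound)
  qed (simp_all add: summable_geometric)
  then show ?thesis by (simp only: hypergeo_F_half half_binomial_series)
qed

text \<open>
  Gauss's product for each of the four Gamma values; the powers of \<open>N\<close> in it cancel because
  \<open>p + q = u + v\<close>.
\<close>

lemma pochhammer_quotient_tendsto_Gamma:
  fixes p q u v :: complex
  assumes sum: "p + q = u + v" and u: "u \<notin> \<int>\<^sub>\<le>\<^sub>0" and v: "v \<notin> \<int>\<^sub>\<le>\<^sub>0"
  shows "(\<lambda>N. pochhammer p N * pochhammer q N / (pochhammer u N * pochhammer v N))
           \<longlonglongrightarrow> Gamma u * Gamma v * rGamma p * rGamma q"
proof -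
  have "(\<lambda>N. rGamma_series p N * rGamma_series q N / (rGamma_series u N * rGamma_series v N))
      \<longlonglongrightarrow> rGamma p * rGamma q / (rGamma u * rGamma v)"
    using u v by (intro tendsto_intros) (simp add: rGamma_eq_zero_iff)
  moreover have "rGamma_series p N * rGamma_series q N / (rGamma_series u N * rGamma_series v N) =
      pochhammer p (Suc N) * pochhammer q (Suc N) / (pochhammer u (Suc N) * pochhammer v (Suc N))" for N
  proof -
    define E :: "complex \<Rightarrow> complex" where "E z = fact N * exp (z * of_real (ln (of_nat N)))" for z
    have "E p * E q = E u * E v"
      using sum by (simp add: E_def mult_ac flip: exp_add distrib_right)
    moreover have "E z \<noteq> 0" for z by (simp add: E_def)
    moreover have "rGamma_series z N = pochhammer z (Suc N) / E z" for z
      by (simp add: rGamma_series_def E_def)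
    ultimately show ?thesis by simp
  qed
  ultimately have "(\<lambda>N. pochhammer p (Suc N) * pochhammer q (Suc N) /
      (pochhammer u (Suc N) * pochhammer v (Suc N))) \<longlonglongrightarrow> rGamma p * rGamma q / (rGamma u * rGamma v)"
    by simp
  then have "(\<lambda>N. pochhammer p N * pochhammer q N / (pochhammer u N * pochhammer v N))
      \<longlonglongrightarrow> rGamma p * rGamma q / (rGamma u * rGamma v)"
    by (rule LIMSEQ_imp_Suc)
  then show ?thesis by (simp add: rGamma_inverse_Gamma field_simps)
qed

theorem mainTheorem7:
  fixes a :: complex
  assumes "3 / 2 - 2 * a \<notin> \<int>\<^sub>\<le>\<^sub>0"
  shows "hypergeo_F (1 / 2) (3 / 2 - 3 * a) (3 / 2 - 2 * a) (- 1 / 3) =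
    complex_of_real (sqrt (2 / 3)) *
      (Gamma (5 / 4 - a) * Gamma (3 / 4 - a) * rGamma (7 / 6 - a) * rGamma (5 / 6 - a))"
proof -
  have "5 / 4 - a \<notin> \<int>\<^sub>\<le>\<^sub>0" "3 / 4 - a \<notin> \<int>\<^sub>\<le>\<^sub>0"
  proof -
    show "5 / 4 - a \<notin> \<int>\<^sub>\<le>\<^sub>0"
    proof
      assume "5 / 4 - a \<in> \<int>\<^sub>\<le>\<^sub>0"
      then obtain n where "5 / 4 - a = - of_nat n" by (rule nonpos_Ints_cases')
      then have "a = 5 / 4 + of_nat n" by (simp add: algebra_simps)
      then have "3 / 2 - 2 * a + of_nat (2 * n + 1) = 0" by simp
      with assms show False using plus_of_nat_eq_0_imp by blast
    qed
    show "3 / 4 - a \<notin> \<int>\<^sub>\<le>\<^sub>0"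
    proof
      assume "3 / 4 - a \<in> \<int>\<^sub>\<le>\<^sub>0"
      then obtain n where "3 / 4 - a = - of_nat n" by (rule nonpos_Ints_cases')
      then have "a = 3 / 4 + of_nat n" by (simp add: algebra_simps)
      then have "3 / 2 - 2 * a + of_nat (2 * n) = 0" by simp
      with assms show False using plus_of_nat_eq_0_imp by blast
    qed
  qed
  then have "(\<lambda>N. pochhammer (7 / 6 - a) N * pochhammer (5 / 6 - a) N /
      (pochhammer (5 / 4 - a) N * pochhammer (3 / 4 - a) N) *
      hypergeo_F (1 / 2) (3 / 2 - 3 * a + 3 * of_nat N) (3 / 2 - 2 * a + 2 * of_nat N) (- 1 / 3))
    \<longlonglongrightarrow> Gamma (5 / 4 - a) * Gamma (3 / 4 - a) * rGamma (7 / 6 - a) * rGamma (5 / 6 - a) *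
        complex_of_real (sqrt (2 / 3))"
    by (intro tendsto_mult pochhammer_quotient_tendsto_Gamma hypergeo_F_half_tendsto) simp_all
  then show ?thesis
    unfolding hypergeo_F_half_iterate[OF assms, symmetric] LIMSEQ_const_iff
    by (simp only: mult.commute)
qed

end
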